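(* Let $d \ge 2$ and let $E \subset S^{d-1} = \left\{x \in \mathbb{R}^d : \sqrt{x_1^2 + x_2^2 + \dots + x_d^2} = 1\right\}$ have Hausdorff dimension $> \frac d2$. Let $\mu_E$ be a Frostman measure on $E$. Then $$\mathcal{L}^1(\{|x-y| : x \in E\}) > 0$$ for $\mu_E$-almost every $y \in E$.
   Context: $\mathcal{L}^1$ is one-dimensional Lebesgue (outer) measure and $|\cdot|$ is the Euclidean norm. A Frostman measure on a set $E$ of Hausdorff dimension $s$ is a compactly supported Borel probability measure $\mu$ supported on $E$ such that for every $\epsilon>0$ there is $C_\epsilon$ with $\mu(B(x,r)) \le C_\epsilon r^{s-\epsilon}$ for all $x$ and all small $r>0$. *)

theory Defs
  imports "HOL-Probability.Probability"
begin

(* The gauge (diam U)^s. The empty set contributes 0, and 0^0 = 1 for nonempty sets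
   (powr would give 0 powr 0 = 0), so that the measure for s = 0 is counting measure. *)
definition hausdorff_gauge :: "real \<Rightarrow> 'a::metric_space set \<Rightarrow> ennreal" where
  "hausdorff_gauge s U =
     (if U = {} then 0 else if s = 0 then 1 else ennreal (diameter U powr s))"

(* Boundedness is required because diameter is a real number and carries no information
   about unbounded sets. If A has no admissible cover, the infimum is infinity. *)
definition hausdorff_premeasure :: "real \<Rightarrow> real \<Rightarrow> 'a::metric_space set \<Rightarrow> ennreal" where
  "hausdorff_premeasure \<delta> s A =
     (INF U \<in> {U :: nat \<Rightarrow> 'a set. A \<subseteq> (\<Union>i. U i) \<and> (\<forall>i. bounded (U i) \<and> diameter (U i) \<le> \<delta>)}.
        \<Sum>i. hausdorff_gauge s (U i))"

definition hausdorff_measure :: "real \<Rightarrow> 'a::metric_space set \<Rightarrow> ennreal" where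
  "hausdorff_measure s A = (SUP \<delta>\<in>{0<..}. hausdorff_premeasure \<delta> s A)"

(* In a Euclidean space the set below is nonempty (it contains every s > DIM('a)) and
   bounded below by 0, so the real-valued infimum is the true one. *)
definition hausdorff_dim :: "'a::euclidean_space set \<Rightarrow> real" where
  "hausdorff_dim A = Inf {s. 0 \<le> s \<and> hausdorff_measure s A = 0}"

definition measure_support :: "'a::metric_space measure \<Rightarrow> 'a set" where
  "measure_support \<mu> = {x. \<forall>r>0. emeasure \<mu> (ball x r) > 0}"

(* "Supported on E" is read as: the complement of E is contained in a null set.
   E need not be measurable. The constant C and the range of small radii depend on
   eps but not on the centre x. *)
definition frostman_measure_on :: "'a::euclidean_space set \<Rightarrow> 'a measure \<Rightarrow> bool" where
  "frostman_measure_on E \<mu> \<longleftrightarrow>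
     sets \<mu> = sets borel \<and> prob_space \<mu> \<and>
     compact (measure_support \<mu>) \<and> (AE x in \<mu>. x \<in> E) \<and>
     (\<forall>\<epsilon>>0. \<exists>C. \<forall>\<^sub>F r in at_right 0. \<forall>x.
        measure \<mu> (cball x r) \<le> C * r powr (hausdorff_dim E - \<epsilon>))"

end

theory Submission
  imports Defs "HOL-Real_Asymp.Real_Asymp"
begin

text \<open>
  On the unit sphere \<open>\<bar>x - y\<bar>\<^sup>2 = 2 - 2 x \<bullet> y\<close>, so the distances from \<open>y\<close> are controlled by the
  projection of \<open>E\<close> to the line through \<open>y\<close>, and the claim becomes a projection theorem for
  \<open>\<mu>\<close>-almost every direction \<open>y\<close>. Let \<open>P = \<bar>F\<bar>\<^sup>2\<close>, where \<open>F\<close> is the Fourier transform of \<open>\<mu>\<close>, and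
  fix \<open>d/2 < t < dim E\<close>. It suffices that the mass of \<open>P\<close> in a Gaussian neighbourhood of the line
  through \<open>y\<close> is finite, because this bounds \<open>(\<mu> \<times> \<mu>){\<bar>y \<bullet> (x - x')\<bar> \<le> \<delta>}\<close> by a multiple of \<open>\<delta>\<close>.
  Averaged over \<open>y\<close>, the weight of a frequency \<open>u\<close> in these neighbourhoods is \<open>O((1 + \<bar>u\<bar>)\<^sup>-\<^sup>t)\<close> by the
  Frostman condition on the directions, while the same condition gives mass \<open>O(R\<^sup>d\<^sup>-\<^sup>t)\<close> of \<open>P\<close> on
  the ball of radius \<open>R\<close>. The dyadic sum of \<open>R\<^sup>d\<^sup>-\<^sup>2\<^sup>t\<close> converges since \<open>t > d/2\<close>.
\<close>

section \<open>Fourier integrals of Gaussians\<close>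

text \<open>The substitution \<open>u = a + c * x\<close> reduces this to the characteristic
  function of the standard normal distribution; the shift by \<open>a\<close> turns into the phase
  \<open>cis (a * z)\<close>.\<close>

lemma gaussian_fourier_real:
  fixes a l z :: real
  assumes "0 < l"
  shows "has_bochner_integral lborel (\<lambda>u. exp (- l * (u - a)\<^sup>2) *\<^sub>R cis (u * z))
           ((sqrt (pi / l) * exp (- z\<^sup>2 / (4 * l))) *\<^sub>R cis (a * z))"
proof -
  \<comment> \<open>\<open>c\<close> is the standard deviation of the Gaussian with exponent
    \<open>- l * u\<^sup>2\<close>, so that \<open>l * c\<^sup>2 = 1 / 2\<close>.\<close>
  define c where "c = 1 / sqrt (2 * l)"
  have c: "c > 0" "c\<^sup>2 = 1 / (2 * l)" using assms by (auto simp: c_def power_divide)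
  have i: "integrable std_normal_distribution (\<lambda>x. iexp ((c * z) * x))"
    using real_dist_normal_dist unfolding real_distribution_def
    by (intro prob_space.integrable_iexp) auto
  have "has_bochner_integral lborel (\<lambda>x. std_normal_density x *\<^sub>R iexp ((c * z) * x))
          (complex_of_real (exp (- ((c * z)\<^sup>2) / 2)))"
    using i fun_cong[OF char_std_normal_distribution, of "c * z"]
    by (simp add: has_bochner_integral_iff integrable_density integral_density char_def)
  then have "has_bochner_integral lborel
      (\<lambda>x. (sqrt (2 * pi) *\<^sub>R cis (a * z)) * (std_normal_density x *\<^sub>R iexp ((c * z) * x)))
      ((sqrt (2 * pi) *\<^sub>R cis (a * z)) * (complex_of_real (exp (- ((c * z)\<^sup>2) / 2))))"
    by (rule has_bochner_integral_mult_right)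
  also have "(\<lambda>x. (sqrt (2 * pi) *\<^sub>R cis (a * z)) * (std_normal_density x *\<^sub>R iexp ((c * z) * x)))
    = (\<lambda>x. exp (- l * ((a + c * x) - a)\<^sup>2) *\<^sub>R cis ((a + c * x) * z))"
  proof
    fix x
    have "sqrt (2 * pi) * std_normal_density x = exp (- x\<^sup>2 / 2)"
      by (simp add: normal_density_def)
    moreover have "- l * ((a + c * x) - a)\<^sup>2 = - x\<^sup>2 / 2"
      using assms by (simp add: power_mult_distrib c)
    moreover have "cis (a * z) * iexp ((c * z) * x) = cis ((a + c * x) * z)"
      by (simp add: cis_conv_exp exp_add[symmetric] algebra_simps)
    ultimately show "(sqrt (2 * pi) *\<^sub>R cis (a * z)) * (std_normal_density x *\<^sub>R iexp ((c * z) * x))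
      = exp (- l * ((a + c * x) - a)\<^sup>2) *\<^sub>R cis ((a + c * x) * z)"
      unfolding \<open>- l * _ = _\<close> \<open>_ = exp (- x\<^sup>2 / 2)\<close>[symmetric] \<open>_ = cis ((a + c * x) * z)\<close>[symmetric]
      by (simp add: scaleR_conv_of_real)
  qed
  also have "(sqrt (2 * pi) *\<^sub>R cis (a * z)) * (complex_of_real (exp (- ((c * z)\<^sup>2) / 2)))
    = ((sqrt (pi / l) * exp (- z\<^sup>2 / (4 * l))) *\<^sub>R cis (a * z)) /\<^sub>R \<bar>c\<bar>"
  proof -
    have s: "sqrt (2 * pi) = sqrt (pi / l) / c"
      using assms by (simp add: c_def real_sqrt_mult real_sqrt_divide)
    have e: "- (c * z)\<^sup>2 / 2 = - z\<^sup>2 / (4 * l)"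
      by (simp add: power_mult_distrib c)
    show ?thesis
      unfolding scaleR_conv_of_real s e using c(1) by (simp add: field_simps)
  qed
  finally show ?thesis
    using lborel_has_bochner_integral_real_affine_iff[of c] c by blast
qed

text \<open>Both the Gaussian and the character split into products over the coordinates, so the
  integral is a product of one-dimensional ones.\<close>

lemma gaussian_fourier:
  fixes a z :: "'a::euclidean_space"
  assumes "0 < l"
  shows "has_bochner_integral lborel (\<lambda>u. exp (- l * (norm (u - a))\<^sup>2) *\<^sub>R cis (u \<bullet> z))
           ((sqrt (pi / l) ^ DIM('a) * exp (- (norm z)\<^sup>2 / (4 * l))) *\<^sub>R cis (a \<bullet> z))"
proof -
  interpret product_sigma_finite "\<lambda>_::'a. lborel :: real measure" ..
  let ?f = "\<lambda>b u. exp (- l * (u - a \<bullet> b)\<^sup>2) *\<^sub>R cis (u * (z \<bullet> b))"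
  let ?v = "\<lambda>b. (sqrt (pi / l) * exp (- (z \<bullet> b)\<^sup>2 / (4 * l))) *\<^sub>R cis ((a \<bullet> b) * (z \<bullet> b))"
  have f: "has_bochner_integral lborel (?f b) (?v b)" for b
    using gaussian_fourier_real[OF assms] .
  have cis_sum: "cis (\<Sum>b\<in>B. g b) = (\<Prod>b\<in>B. cis (g b))" for B and g :: "'a \<Rightarrow> real"
    by (induction B rule: infinite_finite_induct) (auto simp flip: cis_mult)
  have eq: "exp (- l * (norm (u - a))\<^sup>2) *\<^sub>R cis (u \<bullet> z) = (\<Prod>b\<in>Basis. ?f b (u \<bullet> b))" for u
  proof -
    have "exp (- l * (norm (u - a))\<^sup>2) = (\<Prod>b\<in>Basis. exp (- l * (u \<bullet> b - a \<bullet> b)\<^sup>2))"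
      unfolding exp_sum[OF finite_Basis, symmetric] power2_norm_eq_inner
      by (subst euclidean_inner) (simp add: inner_diff_left power2_eq_square sum_distrib_left sum_negf)
    moreover have "cis (u \<bullet> z) = (\<Prod>b\<in>Basis. cis (u \<bullet> b * (z \<bullet> b)))"
      unfolding cis_sum[symmetric] by (subst euclidean_inner) simp
    ultimately show ?thesis
      by (simp add: scaleR_conv_of_real prod.distrib)
  qed
  have "has_bochner_integral (\<Pi>\<^sub>M b\<in>Basis. lborel) (\<lambda>x. \<Prod>b\<in>Basis. ?f b (x b)) (\<Prod>b\<in>Basis. ?v b)"
    using f unfolding has_bochner_integral_iff
    by (intro conjI product_integrable_prod, simp_all del: scaleR_conv_of_real)
       (subst product_integral_prod, simp_all)
  moreover have "(\<Prod>b\<in>Basis. ?v b) =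
     (sqrt (pi / l) ^ DIM('a) * exp (- (norm z)\<^sup>2 / (4 * l))) *\<^sub>R cis (a \<bullet> z)"
  proof -
    have "exp (- (norm z)\<^sup>2 / (4 * l)) = (\<Prod>b\<in>Basis. exp (- (z \<bullet> b)\<^sup>2 / (4 * l)))"
      unfolding exp_sum[OF finite_Basis, symmetric] power2_norm_eq_inner
      by (subst euclidean_inner) (simp add: power2_eq_square sum_divide_distrib sum_negf)
    moreover have "cis (a \<bullet> z) = (\<Prod>b\<in>Basis. cis (a \<bullet> b * (z \<bullet> b)))"
      unfolding cis_sum[symmetric] by (subst euclidean_inner) simp
    ultimately show ?thesis
      by (simp add: scaleR_conv_of_real prod.distrib)
  qed
  ultimately have "has_bochner_integral (\<Pi>\<^sub>M b\<in>Basis. lborel)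
     (\<lambda>x. \<Prod>b\<in>Basis. ?f b ((\<Sum>i\<in>Basis. x i *\<^sub>R i) \<bullet> b)) 
     ((sqrt (pi / l) ^ DIM('a) * exp (- (norm z)\<^sup>2 / (4 * l))) *\<^sub>R cis (a \<bullet> z))"
    by simp
  then show ?thesis
    unfolding eq[symmetric]
    by (subst lborel_eq)
       (auto intro!: has_bochner_integral_distr borel_measurable_continuous_onI continuous_intros)
qed

lemma real_gaussian_fourier:
  fixes a z :: "'a::euclidean_space"
  assumes "0 < l"
  shows "has_bochner_integral lborel (\<lambda>u. exp (- l * (norm (u - a))\<^sup>2) * cos (u \<bullet> z))
           (sqrt (pi / l) ^ DIM('a) * exp (- (norm z)\<^sup>2 / (4 * l)) * cos (a \<bullet> z))"
  using has_bochner_integral_bounded_linear[OF bounded_linear_Re gaussian_fourier[OF assms, of a z]]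
  by simp

lemma gaussian_integral:
  fixes a :: "'a::euclidean_space"
  assumes "0 < l"
  shows "has_bochner_integral lborel (\<lambda>u. exp (- l * (norm (u - a))\<^sup>2)) (sqrt (pi / l) ^ DIM('a))"
  using real_gaussian_fourier[OF assms, of a 0] by simp

text \<open>Exchanging the integrals leaves, for each \<open>p\<close>, the cosine transform of a
  Gaussian. This serves twice: with \<open>w = 1\<close> and \<open>g\<close> the difference of two
  points, to average the power spectrum; and with a Gaussian \<open>w\<close> and \<open>g\<close>
  the component of the difference along \<open>y\<close>, to integrate along the line through
  \<open>y\<close>.\<close>

lemma gaussian_cos_integral:
  fixes Q :: "'b measure" and g :: "'b \<Rightarrow> 'a::euclidean_space" and w :: "'b \<Rightarrow> real"
  assumes "finite_measure Q" and [measurable]: "g \<in> borel_measurable Q" "w \<in> borel_measurable Q"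
    and w: "\<And>p. \<bar>w p\<bar> \<le> 1" and l: "0 < l"
  shows "has_bochner_integral lborel
           (\<lambda>u. exp (- l * (norm (u - a))\<^sup>2) * (\<integral>p. w p * cos (u \<bullet> g p) \<partial>Q))
           (sqrt (pi / l) ^ DIM('a) *
             (\<integral>p. w p * exp (- (norm (g p))\<^sup>2 / (4 * l)) * cos (a \<bullet> g p) \<partial>Q))"
proof -
  interpret Q: finite_measure Q by fact
  interpret pair_sigma_finite lborel Q ..
  let ?e = "\<lambda>u. exp (- l * (norm (u - a))\<^sup>2)"
  let ?F = "\<lambda>(u, p). ?e u * (w p * cos (u \<bullet> g p))"
  have e: "integrable lborel ?e"
    using gaussian_integral[OF l, of a] by (simp add: has_bochner_integral_iff)
  have wc: "\<bar>w p * cos (u \<bullet> g p)\<bar> \<le> 1" for u p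
    unfolding abs_mult using w[of p] by (intro mult_le_one) auto
  have Qi: "integrable Q (\<lambda>p. w p * cos (u \<bullet> g p))" for u
    by (rule Q.integrable_const_bound[of _ 1]) (use wc in auto)
  have [measurable]: "?F \<in> borel_measurable (lborel \<Otimes>\<^sub>M Q)" by measurable
  have F: "integrable (lborel \<Otimes>\<^sub>M Q) ?F"
  proof (rule Fubini_integrable)
    show "integrable lborel (\<lambda>u. \<integral>p. norm (?F (u, p)) \<partial>Q)"
    proof (rule Bochner_Integration.integrable_bound)
      show "integrable lborel (\<lambda>u. ?e u * measure Q (space Q))"
        using e by simp
      have "(\<integral>p. norm (?F (u, p)) \<partial>Q) \<le> (\<integral>p. ?e u \<partial>Q)" for u
      proof (rule integral_mono)
        show "integrable Q (\<lambda>p. norm (?F (u, p)))"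
          using Qi by (simp add: abs_mult[of "?e u"])
        show "norm (?F (u, p)) \<le> ?e u" for p
          using mult_left_mono[OF wc[of p u], of "?e u"]
          by (simp add: abs_mult)
      qed simp
      then show "AE u in lborel. norm (\<integral>p. norm (?F (u, p)) \<partial>Q) \<le> norm (?e u * measure Q (space Q))"
        by (auto simp: mult.commute)
    qed measurable
    show "AE u in lborel. integrable Q (\<lambda>p. ?F (u, p))"
      using Qi by simp
  qed measurable
  have "(\<integral>u. (\<integral>p. ?F (u, p) \<partial>Q) \<partial>lborel) = (\<integral>p. (\<integral>u. ?F (u, p) \<partial>lborel) \<partial>Q)"
    using Fubini_integral[of "\<lambda>u p. ?F (u, p)"] F by simp
  also have "\<dots> = (\<integral>p. sqrt (pi / l) ^ DIM('a) * (w p * exp (- (norm (g p))\<^sup>2 / (4 * l)) * cos (a \<bullet> g p)) \<partial>Q)"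
  proof (rule Bochner_Integration.integral_cong[OF refl])
    fix p
    have "(\<integral>u. ?F (u, p) \<partial>lborel) = (\<integral>u. w p * (?e u * cos (u \<bullet> g p)) \<partial>lborel)"
      by (simp add: mult_ac)
    also have "\<dots> = w p * (\<integral>u. ?e u * cos (u \<bullet> g p) \<partial>lborel)"
      by (rule integral_mult_right_zero)
    also have "\<dots> = sqrt (pi / l) ^ DIM('a) * (w p * exp (- (norm (g p))\<^sup>2 / (4 * l)) * cos (a \<bullet> g p))"
      using real_gaussian_fourier[OF l, of a "g p"] by (simp add: has_bochner_integral_iff)
    finally show "(\<integral>u. ?F (u, p) \<partial>lborel) =
      sqrt (pi / l) ^ DIM('a) * (w p * exp (- (norm (g p))\<^sup>2 / (4 * l)) * cos (a \<bullet> g p))" .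
  qed
  finally have eq: "(\<integral>u. ?e u * (\<integral>p. w p * cos (u \<bullet> g p) \<partial>Q) \<partial>lborel) =
     sqrt (pi / l) ^ DIM('a) * (\<integral>p. w p * exp (- (norm (g p))\<^sup>2 / (4 * l)) * cos (a \<bullet> g p) \<partial>Q)"
    by simp
  have "integrable lborel (\<lambda>u. ?e u * (\<integral>p. w p * cos (u \<bullet> g p) \<partial>Q))"
    using integrable_fst'[OF F] by simp
  with eq show ?thesis
    by (simp add: has_bochner_integral_iff)
qed

section \<open>Absolute continuity from a correlation bound\<close>

text \<open>The bound keeps the averages of \<rho> over intervals of radius \<delta> bounded in L2,
  uniformly in \<delta>. Such averages cannot place a fixed mass on an open set of small Lebesgue
  measure, and \<open>A\<close> is approximated by such sets.\<close>

lemma emeasure_null_set_eq_0_if_correlation_bound: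
  fixes \<rho> :: "real measure"
  assumes "prob_space \<rho>" and sets [measurable_cong]: "sets \<rho> = sets borel"
    and A: "A \<in> sets borel" "emeasure lborel A = 0" and C: "0 \<le> C"
    and corr: "\<And>\<delta>. 0 < \<delta> \<Longrightarrow>
      (\<integral>\<^sup>+u. \<integral>\<^sup>+v. indicator {..\<delta>} \<bar>u - v\<bar> \<partial>\<rho> \<partial>\<rho>) \<le> ennreal (C * \<delta>)"
  shows "emeasure \<rho> A = 0"
proof (rule ccontr)
  interpret prob_space \<rho> by fact
  interpret pair_sigma_finite \<rho> lborel ..
  assume "emeasure \<rho> A \<noteq> 0"
  then have "0 < (SUP K \<in> {K. K \<subseteq> A \<and> compact K}. emeasure \<rho> K)"
    using inner_regular[OF sets _ A(1)] by (simp add: zero_less_iff_neq_zero)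
  then obtain K where K: "K \<subseteq> A" "compact K" "0 < emeasure \<rho> K"
    unfolding less_SUP_iff by auto
  define k where "k = measure \<rho> K"
  have k: "0 < k" "emeasure \<rho> K = ennreal k"
    using K by (auto simp: k_def emeasure_eq_measure)
  have [measurable]: "K \<in> sets borel" using K by (intro borel_compact)
  have "emeasure lborel K \<le> emeasure lborel A"
    using K A by (intro emeasure_mono) auto
  then have K0: "emeasure lborel K = 0" using A by simp
  \<comment> \<open>Weight for splitting a product into squares below. After division by \<delta>,
    the quadratic term contributes \<open>k * (C / (C + 1))\<close>, at most \<open>k\<close>, and
    the choice of \<open>U\<close> makes the other term less than \<open>k\<close>, against
    \<open>2 * k\<close> on the left. The \<open>+ 1\<close> covers \<open>C = 0\<close>.\<close>
  define a where "a = k / (2 * (C + 1))"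
  have a: "0 < a" using k C by (simp add: a_def)
  obtain U where U: "open U" "K \<subseteq> U" "emeasure lborel (U - K) < ennreal (k\<^sup>2 / (C + 1))"
    using outer_regular_lborel[of K "k\<^sup>2 / (C + 1)"] k C by auto
  have [measurable]: "U \<in> sets borel" using U by (intro borel_open)
  have "emeasure lborel U = emeasure lborel (U - K)"
    using U(2) K0 by (subst emeasure_Diff_null_set) (auto simp: null_sets_def)
  with U(3) have LU: "emeasure lborel U < ennreal (k\<^sup>2 / (C + 1))" by simp
  define L where "L = measure lborel U"
  have L: "emeasure lborel U = ennreal L" "L < k\<^sup>2 / (C + 1)" "0 \<le> L"
  proof -
    have "emeasure lborel U \<noteq> \<top>" using LU by auto
    then show "emeasure lborel U = ennreal L" unfolding L_def by (rule emeasure_eq_ennreal_measure)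
    with LU show "L < k\<^sup>2 / (C + 1)" by (simp add: L_def ennreal_less_iff)
    show "0 \<le> L" by (simp add: L_def)
  qed
  obtain \<epsilon> where \<epsilon>: "\<epsilon> > 0" "(\<Union>x\<in>K. ball x \<epsilon>) \<subseteq> U"
    using compact_subset_open_imp_ball_epsilon_subset[OF K(2) U(1,2)] .
  define \<delta> where "\<delta> = \<epsilon> / 2"
  have \<delta>: "0 < \<delta>" using \<epsilon> by (simp add: \<delta>_def)
  have ball: "v \<in> U" if "u \<in> K" "\<bar>u - v\<bar> \<le> \<delta>" for u v
    using that \<epsilon> by (auto simp: \<delta>_def dist_real_def subset_eq)
  define f where "f v = (\<integral>\<^sup>+u. indicator {..\<delta>} \<bar>u - v\<bar> \<partial>\<rho>)" for v :: real
  have [measurable]: "f \<in> borel_measurable borel" unfolding f_def by measurable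
  have f1: "f v \<le> 1" for v
  proof -
    have "f v \<le> (\<integral>\<^sup>+u. 1 \<partial>\<rho>)" unfolding f_def by (intro nn_integral_mono) (auto simp: indicator_def)
    then show ?thesis by (simp add: emeasure_space_1)
  qed
  have len: "(\<integral>\<^sup>+v. indicator {..\<delta>} \<bar>u - v\<bar> \<partial>lborel) = ennreal (2 * \<delta>)" for u :: real
  proof -
    have "(\<lambda>v. indicator {..\<delta>} \<bar>u - v\<bar> :: ennreal) = indicator {u - \<delta>..u + \<delta>}"
      by (auto simp: indicator_def abs_le_iff fun_eq_iff)
    then show ?thesis using \<delta> by simp
  qed
  \<comment> \<open>Double counting: every \<open>u\<close> in \<open>K\<close> sees a full interval
    of length \<open>2 * \<delta>\<close> inside \<open>U\<close>.\<close>
  have "ennreal (2 * \<delta> * k) = (\<integral>\<^sup>+u. indicator K u * (\<integral>\<^sup>+v. indicator {..\<delta>} \<bar>u - v\<bar> \<partial>lborel) \<partial>\<rho>)"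
    unfolding len using k \<delta>
    by (subst nn_integral_multc) (auto simp: ennreal_mult'' mult.commute)
  also have "\<dots> = (\<integral>\<^sup>+u. (\<integral>\<^sup>+v. indicator K u * indicator {..\<delta>} \<bar>u - v\<bar> \<partial>lborel) \<partial>\<rho>)"
    by (intro nn_integral_cong nn_integral_cmult[symmetric]) measurable
  also have "\<dots> \<le> (\<integral>\<^sup>+u. (\<integral>\<^sup>+v. indicator U v * indicator {..\<delta>} \<bar>u - v\<bar> \<partial>lborel) \<partial>\<rho>)"
    by (intro nn_integral_mono) (auto simp: indicator_def ball)
  also have "\<dots> = (\<integral>\<^sup>+v. (\<integral>\<^sup>+u. indicator U v * indicator {..\<delta>} \<bar>u - v\<bar> \<partial>\<rho>) \<partial>lborel)"
    by (rule Fubini'[symmetric]) measurable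
  also have "\<dots> = (\<integral>\<^sup>+v. indicator U v * f v \<partial>lborel)"
    unfolding f_def by (intro nn_integral_cong nn_integral_cmult) measurable
  \<comment> \<open>Expanding \<open>0 \<le> (\<delta> - a * x)\<^sup>2\<close> gives this pointwise
    bound, which takes the place of the Cauchy-Schwarz inequality.\<close>
  also have "\<dots> \<le> (\<integral>\<^sup>+v. ennreal (\<delta> / (2 * a)) * indicator U v + ennreal (a / (2 * \<delta>)) * (f v * f v) \<partial>lborel)"
  proof (intro nn_integral_mono)
    fix v
    obtain x where x: "f v = ennreal x" "0 \<le> x" using f1[of v] by (cases "f v") (auto simp: top_unique)
    have "x \<le> \<delta> / (2 * a) + a / (2 * \<delta>) * (x * x)"
    proof -
      have "0 \<le> (\<delta> - a * x)\<^sup>2 / (2 * a * \<delta>)" using a \<delta> by simp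
      also have "\<dots> = \<delta> / (2 * a) + a / (2 * \<delta>) * (x * x) - x"
        using a \<delta> by (simp add: field_simps power2_eq_square)
      finally show ?thesis by simp
    qed
    then show "indicator U v * f v \<le> ennreal (\<delta> / (2 * a)) * indicator U v + ennreal (a / (2 * \<delta>)) * (f v * f v)"
      using x a \<delta> by (auto simp: indicator_def simp flip: ennreal_mult ennreal_plus)
  qed
  also have "\<dots> = ennreal (\<delta> / (2 * a)) * ennreal L + ennreal (a / (2 * \<delta>)) * (\<integral>\<^sup>+v. f v * f v \<partial>lborel)"
    by (subst nn_integral_add) (auto simp: nn_integral_cmult L)
  also have "\<dots> \<le> ennreal (\<delta> / (2 * a)) * ennreal L + ennreal (a / (2 * \<delta>)) * ennreal (4 * C * \<delta>\<^sup>2)"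
  proof (intro add_left_mono mult_left_mono)
    have "(\<integral>\<^sup>+v. f v * f v \<partial>lborel) =
      (\<integral>\<^sup>+v. (\<integral>\<^sup>+u. indicator {..\<delta>} \<bar>u - v\<bar> * f v \<partial>\<rho>) \<partial>lborel)"
      by (simp add: nn_integral_multc f_def)
    also have "\<dots> = (\<integral>\<^sup>+u. (\<integral>\<^sup>+v. indicator {..\<delta>} \<bar>u - v\<bar> * f v \<partial>lborel) \<partial>\<rho>)"
      by (rule Fubini') measurable
    also have "\<dots> = (\<integral>\<^sup>+u. (\<integral>\<^sup>+v. (\<integral>\<^sup>+w. indicator {..\<delta>} \<bar>u - v\<bar> * indicator {..\<delta>} \<bar>w - v\<bar> \<partial>\<rho>) \<partial>lborel) \<partial>\<rho>)"
      unfolding f_def by (intro nn_integral_cong nn_integral_cmult[symmetric]) measurable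
    also have "\<dots> = (\<integral>\<^sup>+u. (\<integral>\<^sup>+w. (\<integral>\<^sup>+v. indicator {..\<delta>} \<bar>u - v\<bar> * indicator {..\<delta>} \<bar>w - v\<bar> \<partial>lborel) \<partial>\<rho>) \<partial>\<rho>)"
      by (intro nn_integral_cong Fubini') measurable
    \<comment> \<open>Two points within \<delta> of \<open>v\<close> are within
      \<open>2 * \<delta>\<close> of each other. Keeping only one of the two conditions on
      \<open>v\<close> then leaves an interval of length \<open>2 * \<delta>\<close>.\<close>
    also have "\<dots> \<le> (\<integral>\<^sup>+u. (\<integral>\<^sup>+w. (\<integral>\<^sup>+v. indicator {..2 * \<delta>} \<bar>u - w\<bar> * indicator {..\<delta>} \<bar>u - v\<bar> \<partial>lborel) \<partial>\<rho>) \<partial>\<rho>)"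
      by (intro nn_integral_mono) (auto simp: indicator_def)
    also have "\<dots> = (\<integral>\<^sup>+u. (\<integral>\<^sup>+w. indicator {..2 * \<delta>} \<bar>u - w\<bar> * ennreal (2 * \<delta>) \<partial>\<rho>) \<partial>\<rho>)"
      by (simp add: nn_integral_cmult len)
    also have "\<dots> = (\<integral>\<^sup>+u. (\<integral>\<^sup>+w. indicator {..2 * \<delta>} \<bar>u - w\<bar> \<partial>\<rho>) \<partial>\<rho>) * ennreal (2 * \<delta>)"
      by (simp add: nn_integral_multc)
    also have "\<dots> \<le> ennreal (C * (2 * \<delta>)) * ennreal (2 * \<delta>)"
      using \<delta> by (intro mult_right_mono corr) auto
    also have "\<dots> = ennreal (4 * C * \<delta>\<^sup>2)"
      using \<delta> C by (simp flip: ennreal_mult add: power2_eq_square mult_ac)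
    finally show "(\<integral>\<^sup>+v. f v * f v \<partial>lborel) \<le> ennreal (4 * C * \<delta>\<^sup>2)" .
  qed simp
  also have "\<dots> = ennreal (\<delta> / (2 * a) * L + a / (2 * \<delta>) * (4 * C * \<delta>\<^sup>2))"
    using a \<delta> C L(3) by (subst ennreal_plus) (simp_all only: ennreal_mult divide_nonneg_pos mult_nonneg_nonneg zero_le_power2 zero_less_mult_iff less_imp_le zero_less_numeral simp_thms zero_le_numeral)
  finally have "ennreal (2 * \<delta> * k) \<le> ennreal (\<delta> / (2 * a) * L + a / (2 * \<delta>) * (4 * C * \<delta>\<^sup>2))" .
  then have "2 * \<delta> * k \<le> \<delta> / (2 * a) * L + a / (2 * \<delta>) * (4 * C * \<delta>\<^sup>2)"
    using a \<delta> C L(3) by (subst (asm) ennreal_le_iff) (auto intro!: add_nonneg_nonneg mult_nonneg_nonneg)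
  also have "\<dots> = \<delta> * (L * (C + 1) / k + k * (C / (C + 1)))"
  proof -
    have "\<delta> / (2 * a) * L = \<delta> * (L * (C + 1) / k)"
      using k C by (simp add: a_def field_simps)
    moreover have "a / (2 * \<delta>) * (4 * C * \<delta>\<^sup>2) = \<delta> * (2 * a * C)"
      using \<delta> by (simp add: power2_eq_square)
    moreover have "2 * a * C = k * (C / (C + 1))"
      using C by (simp add: a_def field_simps)
    ultimately show ?thesis by (simp only: distrib_left)
  qed
  also have "\<dots> < \<delta> * (k + k)"
  proof -
    have "L * (C + 1) / k < k" using L(2) k C by (simp add: field_simps power2_eq_square)
    moreover have "k * (C / (C + 1)) \<le> k * 1" using k C by (intro mult_left_mono) auto
    ultimately show ?thesis using \<delta> by (intro mult_strict_left_mono) auto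
  qed
  finally show False by simp
qed

section \<open>Gaussian averages of measures with power growth\<close>

text \<open>The constant lost when a ball is replaced by a Gaussian: on the shell where the scaled
  distance lies between \<open>k\<close> and \<open>k + 1\<close>, the first factor bounds the
  Gaussian and the second the growth of the enclosing ball.\<close>

definition gaussian_shell_sum :: "real \<Rightarrow> real" where
  "gaussian_shell_sum t = (\<Sum>k. exp (- (real k)\<^sup>2) * (real k + 1) powr t)"

lemma summable_gaussian_shell: "summable (\<lambda>k. exp (- (real k)\<^sup>2) * (real k + 1) powr t)"
proof (rule summable_comparison_test_bigo)
  show "summable (\<lambda>k. norm (1 / (real k) ^ 2))"
    using inverse_power_summable[of 2, where ?'a=real] by (simp add: inverse_eq_divide)
  show "(\<lambda>k. exp (- (real k)\<^sup>2) * (real k + 1) powr t) \<in> O(\<lambda>k. 1 / (real k) ^ 2)"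
    by real_asymp
qed

lemma gaussian_shell_sum_nonneg: "0 \<le> gaussian_shell_sum t"
  unfolding gaussian_shell_sum_def by (intro suminf_nonneg summable_gaussian_shell) auto

text \<open>Cut the space into shells of width \<open>1 / R\<close> about \<open>x\<close>; the
  shell of index \<open>k\<close> lies in the ball of radius \<open>(k + 1) / R\<close>. Up to a
  constant, the Gaussian obeys the same bound as one ball of radius \<open>1 / R\<close>.\<close>

lemma nn_integral_gaussian_le:
  fixes \<mu> :: "'a::euclidean_space measure"
  assumes sets [measurable_cong]: "sets \<mu> = sets borel" and C: "0 \<le> C" and R: "0 < R"
    and growth: "\<And>r. 0 < r \<Longrightarrow> emeasure \<mu> (cball x r) \<le> ennreal (C * r powr t)"
  shows "(\<integral>\<^sup>+y. ennreal (exp (- (R * dist y x)\<^sup>2)) \<partial>\<mu>)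
           \<le> ennreal (C * gaussian_shell_sum t * R powr - t)"
proof -
  let ?g = "\<lambda>k. exp (- (real k)\<^sup>2) * (real k + 1) powr t"
  have pt: "ennreal (exp (- (R * dist y x)\<^sup>2)) \<le>
     (\<Sum>k. ennreal (exp (- (real k)\<^sup>2)) * indicator (cball x ((real k + 1) / R)) y)" for y
  proof -
    define n where "n = nat \<lfloor>R * dist y x\<rfloor>"
    have n: "real n \<le> R * dist y x" "R * dist y x \<le> real n + 1"
      using R by (simp_all add: n_def)
    have "ennreal (exp (- (R * dist y x)\<^sup>2)) \<le> ennreal (exp (- (real n)\<^sup>2))"
      using n by (intro ennreal_leI) (auto intro: power_mono)
    also have "\<dots> = (\<Sum>k\<in>{n}. ennreal (exp (- (real k)\<^sup>2)) * indicator (cball x ((real k + 1) / R)) y)"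
      using n R by (simp add: indicator_def field_simps dist_commute)
    also have "\<dots> \<le> (\<Sum>k. ennreal (exp (- (real k)\<^sup>2)) * indicator (cball x ((real k + 1) / R)) y)"
      by (rule sum_le_suminf) auto
    finally show ?thesis .
  qed
  have "(\<integral>\<^sup>+y. ennreal (exp (- (R * dist y x)\<^sup>2)) \<partial>\<mu>) \<le>
    (\<integral>\<^sup>+y. (\<Sum>k. ennreal (exp (- (real k)\<^sup>2)) * indicator (cball x ((real k + 1) / R)) y) \<partial>\<mu>)"
    by (intro nn_integral_mono pt)
  also have "\<dots> = (\<Sum>k. ennreal (exp (- (real k)\<^sup>2)) * emeasure \<mu> (cball x ((real k + 1) / R)))"
    by (subst nn_integral_suminf, measurable) (auto intro!: suminf_cong simp: nn_integral_cmult_indicator sets)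
  also have "\<dots> \<le> (\<Sum>k. ennreal (C * R powr - t * ?g k))"
  proof (rule suminf_le)
    fix k
    have "ennreal (exp (- (real k)\<^sup>2)) * emeasure \<mu> (cball x ((real k + 1) / R)) \<le>
      ennreal (exp (- (real k)\<^sup>2)) * ennreal (C * ((real k + 1) / R) powr t)"
      using R by (intro mult_left_mono growth) auto
    also have "((real k + 1) / R) powr t = (real k + 1) powr t * R powr - t"
      using R by (simp add: powr_divide powr_minus_divide)
    also have "ennreal (exp (- (real k)\<^sup>2)) * ennreal (C * ((real k + 1) powr t * R powr - t)) =
        ennreal (C * R powr - t * ?g k)"
      using C by (simp add: mult_ac flip: ennreal_mult)
    finally show "ennreal (exp (- (real k)\<^sup>2)) * emeasure \<mu> (cball x ((real k + 1) / R)) \<le>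
      ennreal (C * R powr - t * ?g k)" .
  qed auto
  also have "\<dots> = ennreal (\<Sum>k. C * R powr - t * ?g k)"
    using C by (intro suminf_ennreal2 summable_mult summable_gaussian_shell) auto
  also have "(\<Sum>k. C * R powr - t * ?g k) = C * gaussian_shell_sum t * R powr - t"
    unfolding gaussian_shell_sum_def using suminf_mult[OF summable_gaussian_shell, of "C * R powr - t" t]
    by (simp add: mult_ac)
  finally show ?thesis .
qed

text \<open>Pythagoras splits the squared distance from \<open>R *\<^sub>R e\<close> to
  \<open>r *\<^sub>R y\<close> into a part constant in \<open>r\<close> and the square of
  \<open>r - R * (e \<bullet> y)\<close>. The latter integrates to \<open>sqrt (2 * pi)\<close>; the
  Gaussian of the former is concentrated on \<open>y\<close> near \<open>e\<close> or
  \<open>- e\<close>.\<close>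

lemma nn_integral_gaussian_line_le:
  fixes y e :: "'a::euclidean_space"
  assumes y: "norm y = 1" and e: "norm e = 1"
  shows "(\<integral>\<^sup>+r. ennreal (exp (- (norm (R *\<^sub>R e - r *\<^sub>R y))\<^sup>2 / 2)) \<partial>lborel) \<le>
    ennreal (sqrt (2 * pi)) * (ennreal (exp (- (R / 2 * dist y e)\<^sup>2)) + ennreal (exp (- (R / 2 * dist y (- e))\<^sup>2)))"
proof -
  let ?c = "e \<bullet> y"
  have ee: "e \<bullet> e = 1" "y \<bullet> y = 1" using y e by (simp_all add: dot_square_norm)
  have n: "(norm (R *\<^sub>R e - r *\<^sub>R y))\<^sup>2 = R\<^sup>2 * (1 - ?c\<^sup>2) + (r - R * ?c)\<^sup>2" for r
    unfolding power2_norm_eq_inner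
    by (simp add: inner_diff ee inner_commute[of y e] power2_eq_square algebra_simps)
  have d: "(dist y e)\<^sup>2 = 2 - 2 * ?c" "(dist y (- e))\<^sup>2 = 2 + 2 * ?c"
    unfolding dist_norm power2_norm_eq_inner
    by (simp_all add: inner_diff inner_add ee inner_commute[of y e])
  have d': "(R / 2 * dist y e)\<^sup>2 = R\<^sup>2 / 2 * (1 - ?c)" "(R / 2 * dist y (- e))\<^sup>2 = R\<^sup>2 / 2 * (1 + ?c)"
    unfolding power_mult_distrib d by (simp_all add: power_divide algebra_simps)
  have c: "\<bar>?c\<bar> \<le> 1" using Cauchy_Schwarz_ineq2[of e y] y e by simp
  have "(\<integral>\<^sup>+r. ennreal (exp (- (norm (R *\<^sub>R e - r *\<^sub>R y))\<^sup>2 / 2)) \<partial>lborel) =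
    (\<integral>\<^sup>+r. ennreal (exp (- R\<^sup>2 * (1 - ?c\<^sup>2) / 2)) * ennreal (exp (- (1 / 2) * (norm (r - R * ?c))\<^sup>2)) \<partial>lborel)"
  proof (intro nn_integral_cong)
    fix r
    have "- (norm (R *\<^sub>R e - r *\<^sub>R y))\<^sup>2 / 2 = - R\<^sup>2 * (1 - ?c\<^sup>2) / 2 + - (1 / 2) * (norm (r - R * ?c))\<^sup>2"
      unfolding n by (simp add: field_simps)
    then show "ennreal (exp (- (norm (R *\<^sub>R e - r *\<^sub>R y))\<^sup>2 / 2)) =
        ennreal (exp (- R\<^sup>2 * (1 - ?c\<^sup>2) / 2)) * ennreal (exp (- (1 / 2) * (norm (r - R * ?c))\<^sup>2))"
      by (simp only: exp_add ennreal_mult exp_ge_zero)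
  qed
  also have "\<dots> = ennreal (exp (- R\<^sup>2 * (1 - ?c\<^sup>2) / 2)) * ennreal (sqrt (2 * pi))"
    using gaussian_integral[of "1 / 2" "R * ?c"]
    by (subst nn_integral_cmult) (auto simp: has_bochner_integral_iff nn_integral_eq_integral mult.commute)
  also have "ennreal (exp (- R\<^sup>2 * (1 - ?c\<^sup>2) / 2)) \<le>
     ennreal (exp (- (R / 2 * dist y e)\<^sup>2)) + ennreal (exp (- (R / 2 * dist y (- e))\<^sup>2))"
  proof -
    \<comment> \<open>For the nearer of the two poles,
      \<open>1 - ?c\<^sup>2 \<ge> 1 - \<bar>?c\<bar>\<close>, and the right side is half the squared
      distance to that pole. This produces the scale \<open>R / 2\<close>.\<close>
    have "exp (- R\<^sup>2 * (1 - ?c\<^sup>2) / 2) \<le> exp (- (R / 2 * dist y e)\<^sup>2)" if "0 \<le> ?c"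
    proof -
      have "R\<^sup>2 / 2 * (1 - ?c) * 1 \<le> R\<^sup>2 / 2 * (1 - ?c) * (1 + ?c)"
        using c that by (intro mult_left_mono mult_nonneg_nonneg) auto
      then show ?thesis unfolding d' by (simp add: power2_eq_square algebra_simps)
    qed
    moreover have "exp (- R\<^sup>2 * (1 - ?c\<^sup>2) / 2) \<le> exp (- (R / 2 * dist y (- e))\<^sup>2)" if "?c \<le> 0"
    proof -
      have "R\<^sup>2 / 2 * (1 + ?c) * 1 \<le> R\<^sup>2 / 2 * (1 + ?c) * (1 - ?c)"
        using c that by (intro mult_left_mono mult_nonneg_nonneg) auto
      then show ?thesis unfolding d' by (simp add: power2_eq_square algebra_simps)
    qed
    ultimately have "exp (- R\<^sup>2 * (1 - ?c\<^sup>2) / 2) \<le>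
        exp (- (R / 2 * dist y e)\<^sup>2) + exp (- (R / 2 * dist y (- e))\<^sup>2)"
      by (meson add_increasing add_increasing2 exp_ge_zero linear)
    then show ?thesis by (simp flip: ennreal_plus)
  qed
  finally show ?thesis by (simp add: mult.commute mult_right_mono)
qed

text \<open>The lines passing near the frequency \<open>R *\<^sub>R e\<close> have directions within
  about \<open>1 / R\<close> of \<open>e\<close> or \<open>- e\<close>, so growth is applied around
  these two points. The first bound uses only the total mass and serves small
  \<open>R\<close>.\<close>

lemma nn_integral_gaussian_lines_bounds:
  fixes \<mu> :: "'a::euclidean_space measure"
  assumes "prob_space \<mu>" and sets [measurable_cong]: "sets \<mu> = sets borel"
    and sphere: "AE y in \<mu>. norm y = 1" and C: "0 \<le> C" and R: "0 \<le> R" and e: "norm e = 1"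
    and growth: "\<And>x r. 0 < r \<Longrightarrow> emeasure \<mu> (cball x r) \<le> ennreal (C * r powr t)"
  defines "W \<equiv> (\<integral>\<^sup>+y. \<integral>\<^sup>+r. ennreal (exp (- (norm (R *\<^sub>R e - r *\<^sub>R y))\<^sup>2 / 2)) \<partial>lborel \<partial>\<mu>)"
  shows "W \<le> ennreal (2 * sqrt (2 * pi))"
    and "0 < R \<Longrightarrow> W \<le> ennreal (2 * sqrt (2 * pi) * C * gaussian_shell_sum t * (R / 2) powr - t)"
proof -
  interpret prob_space \<mu> by fact
  let ?G = "\<lambda>x y. ennreal (exp (- (R / 2 * dist y x)\<^sup>2))"
  have "W \<le> (\<integral>\<^sup>+y. ennreal (sqrt (2 * pi)) * (?G e y + ?G (- e) y) \<partial>\<mu>)"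
    unfolding W_def
  proof (rule nn_integral_mono_AE)
    show "AE y in \<mu>. (\<integral>\<^sup>+r. ennreal (exp (- (norm (R *\<^sub>R e - r *\<^sub>R y))\<^sup>2 / 2)) \<partial>lborel) \<le>
        ennreal (sqrt (2 * pi)) * (?G e y + ?G (- e) y)"
      using sphere by eventually_elim (rule nn_integral_gaussian_line_le[OF _ e])
  qed
  also have "\<dots> = ennreal (sqrt (2 * pi)) * ((\<integral>\<^sup>+y. ?G e y \<partial>\<mu>) + (\<integral>\<^sup>+y. ?G (- e) y \<partial>\<mu>))"
    by (subst nn_integral_cmult, measurable, subst nn_integral_add) auto
  finally have W: "W \<le> \<dots>" .
  have W2: "W \<le> ennreal (2 * sqrt (2 * pi) * b)" if "0 \<le> b" "\<And>x. (\<integral>\<^sup>+y. ?G x y \<partial>\<mu>) \<le> ennreal b" for b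
  proof -
    have "W \<le> ennreal (sqrt (2 * pi)) * (ennreal b + ennreal b)"
      by (rule order_trans[OF W]) (intro mult_left_mono add_mono that, simp)
    also have "\<dots> = ennreal (2 * sqrt (2 * pi) * b)"
      using that(1) by (simp add: mult_ac flip: ennreal_plus ennreal_mult)
    finally show ?thesis .
  qed
  have "(\<integral>\<^sup>+y. ?G x y \<partial>\<mu>) \<le> ennreal 1" for x
  proof -
    have "(\<integral>\<^sup>+y. ?G x y \<partial>\<mu>) \<le> (\<integral>\<^sup>+y. 1 \<partial>\<mu>)"
      by (intro nn_integral_mono) simp
    then show ?thesis by (simp add: emeasure_space_1)
  qed
  from W2[OF _ this] show "W \<le> ennreal (2 * sqrt (2 * pi))" by simp
  assume "0 < R"
  then have "(\<integral>\<^sup>+y. ?G x y \<partial>\<mu>) \<le> ennreal (C * gaussian_shell_sum t * (R / 2) powr - t)" for x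
    by (intro nn_integral_gaussian_le growth sets C) auto
  from W2[OF _ this] show "W \<le> ennreal (2 * sqrt (2 * pi) * C * gaussian_shell_sum t * (R / 2) powr - t)"
    using C by (simp add: gaussian_shell_sum_nonneg mult_ac)
qed

section \<open>Dyadic decomposition of frequencies\<close>

lemma four_power_eq: "(4::real) ^ k = (2 ^ k)\<^sup>2"
  unfolding power_mult[symmetric] by (subst mult.commute) (simp add: power_mult)

text \<open>One term suffices, the one with \<open>2 ^ k\<close> comparable to
  \<open>max 1 R\<close>. The power decay is thus dominated by Gaussians, whose integrals against
  the power spectrum can be computed.\<close>

lemma powr_minus_le_dyadic_gaussian_sum:
  fixes R t :: real
  assumes t: "0 \<le> t" and R: "0 \<le> R"
  shows "ennreal (max 1 R powr - t) \<le>
           ennreal (exp 4) * (\<Sum>k. ennreal ((2 ^ k) powr - t) * ennreal (exp (- (1 / 4 ^ k) * R\<^sup>2)))"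
proof -
  obtain k :: nat where k: "2 ^ k \<le> max 1 R" "R \<le> 2 * 2 ^ k"
  proof (cases "R \<le> 1")
    case True
    then show ?thesis by (intro that[of 0]) auto
  next
    case False
    define k where "k = nat \<lfloor>log 2 R\<rfloor>"
    have "real k \<le> log 2 R" "log 2 R \<le> real k + 1"
      using False by (simp_all add: k_def)
    then have "2 powr real k \<le> R" "R \<le> 2 powr (real k + 1)"
      using False by (simp_all add: le_log_iff log_le_iff)
    then show ?thesis using False by (intro that[of k]) (simp_all add: powr_add powr_realpow)
  qed
  \<comment> \<open>At this \<open>k\<close> the Gaussian exponent is at least -4, hence the factor
    \<open>exp 4\<close>.\<close>
  have "R\<^sup>2 \<le> (2 * 2 ^ k)\<^sup>2" using k R by (intro power_mono)
  also have "\<dots> = 4 * 4 ^ k" by (simp add: power_mult_distrib four_power_eq)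
  finally have "1 \<le> exp (4 - 1 / 4 ^ k * R\<^sup>2)" by (simp add: field_simps)
  then have "max 1 R powr - t * 1 \<le> (2 ^ k) powr - t * exp (4 - 1 / 4 ^ k * R\<^sup>2)"
    using k(1) t by (intro mult_mono powr_mono2') auto
  then have "ennreal (max 1 R powr - t) \<le> ennreal (exp 4 * ((2 ^ k) powr - t * exp (- (1 / 4 ^ k) * R\<^sup>2)))"
    by (intro ennreal_leI) (simp add: exp_diff exp_minus divide_inverse mult_ac)
  also have "\<dots> = ennreal (exp 4) * (\<Sum>k\<in>{k}. ennreal ((2 ^ k) powr - t) * ennreal (exp (- (1 / 4 ^ k) * R\<^sup>2)))"
    by (simp add: ennreal_mult)
  also have "\<dots> \<le> ennreal (exp 4) * (\<Sum>k. ennreal ((2 ^ k) powr - t) * ennreal (exp (- (1 / 4 ^ k) * R\<^sup>2)))"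
    by (intro mult_left_mono sum_le_suminf) auto
  finally show ?thesis .
qed

lemma nn_integral_gaussian_lines_le_dyadic_sum:
  fixes \<mu> :: "'a::euclidean_space measure"
  assumes "prob_space \<mu>" and sets: "sets \<mu> = sets borel"
    and sphere: "AE y in \<mu>. norm y = 1" and C: "0 \<le> C" and t: "0 \<le> t"
    and growth: "\<And>x r. 0 < r \<Longrightarrow> emeasure \<mu> (cball x r) \<le> ennreal (C * r powr t)"
  obtains M where "0 \<le> M"
    "\<And>u. (\<integral>\<^sup>+y. \<integral>\<^sup>+r. ennreal (exp (- (norm (u - r *\<^sub>R y))\<^sup>2 / 2)) \<partial>lborel \<partial>\<mu>) \<le>
       ennreal M * (\<Sum>k. ennreal ((2 ^ k) powr - t) * ennreal (exp (- (1 / 4 ^ k) * (norm u)\<^sup>2)))"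
proof -
  define c where "c = 2 * sqrt (2 * pi)"
  \<comment> \<open>\<open>2 powr t\<close> absorbs the halving in \<open>(R / 2) powr - t\<close>.
    The constant \<open>c\<close> serves \<open>R \<le> 1\<close> and \<open>c * K\<close> larger
    \<open>R\<close>, so \<open>c * (1 + K)\<close> serves both.\<close>
  define K where "K = C * gaussian_shell_sum t * 2 powr t"
  have cK: "0 \<le> c" "0 \<le> K" using C by (simp_all add: c_def K_def gaussian_shell_sum_nonneg)
  show thesis
  proof (rule that[of "c * (1 + K) * exp 4"])
    show "0 \<le> c * (1 + K) * exp 4" using cK by simp
    fix u :: 'a
    obtain b :: 'a where b: "norm b = 1" using norm_Basis nonempty_Basis by blast
    define R where "R = norm u"
    \<comment> \<open>The frequency 0 has no direction; any unit vector will do there.\<close>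
    define e where "e = (if u = 0 then b else u /\<^sub>R norm u)"
    have e: "norm e = 1" "u = R *\<^sub>R e" "0 \<le> R" using b by (auto simp: e_def R_def)
    let ?W = "\<integral>\<^sup>+y. \<integral>\<^sup>+r. ennreal (exp (- (norm (u - r *\<^sub>R y))\<^sup>2 / 2)) \<partial>lborel \<partial>\<mu>"
    note bounds = nn_integral_gaussian_lines_bounds[OF assms(1) sets sphere C e(3,1) growth, folded e(2)]
    have "?W \<le> ennreal (c * (1 + K) * max 1 R powr - t)"
    proof (cases "R \<le> 1")
      case True
      have "?W \<le> ennreal c" using bounds(1) by (simp add: c_def)
      also have "\<dots> \<le> ennreal (c * (1 + K) * max 1 R powr - t)"
        using cK True by (intro ennreal_leI) (auto simp: max_def algebra_simps)
      finally show ?thesis .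
    next
      case False
      have "?W \<le> ennreal (2 * sqrt (2 * pi) * C * gaussian_shell_sum t * (R / 2) powr - t)"
        using bounds(2) False by simp
      also have "2 * sqrt (2 * pi) * C * gaussian_shell_sum t * (R / 2) powr - t = c * K * R powr - t"
        using False by (simp add: c_def K_def powr_divide powr_minus field_simps)
      also have "ennreal \<dots> \<le> ennreal (c * (1 + K) * max 1 R powr - t)"
        using cK False by (intro ennreal_leI) (auto simp: max_def algebra_simps)
      finally show ?thesis .
    qed
    also have "\<dots> = ennreal (c * (1 + K)) * ennreal (max 1 R powr - t)"
      using cK by (simp add: ennreal_mult)
    also have "\<dots> \<le> ennreal (c * (1 + K)) * (ennreal (exp 4) *
        (\<Sum>k. ennreal ((2 ^ k) powr - t) * ennreal (exp (- (1 / 4 ^ k) * R\<^sup>2))))"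
      by (intro mult_left_mono powr_minus_le_dyadic_gaussian_sum t e) simp
    also have "\<dots> = ennreal (c * (1 + K) * exp 4) *
        (\<Sum>k. ennreal ((2 ^ k) powr - t) * ennreal (exp (- (1 / 4 ^ k) * (norm u)\<^sup>2)))"
      using cK by (simp add: ennreal_mult R_def mult.assoc)
    finally show "?W \<le> \<dots>" .
  qed
qed

section \<open>The power spectrum of a measure\<close>

text \<open>This is the squared modulus of the Fourier transform of \<mu>, with phase
  \<open>u \<bullet> x\<close> and no factor \<open>2 * pi\<close>. The cosine integral over pairs
  keeps it real and fits \<open>gaussian_cos_integral\<close>.\<close>

definition fourier_power :: "'a::euclidean_space measure \<Rightarrow> 'a \<Rightarrow> real" where
  "fourier_power \<mu> u = (\<integral>p. cos (u \<bullet> (fst p - snd p)) \<partial>(\<mu> \<Otimes>\<^sub>M \<mu>))"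

text \<open>The addition formula for the cosine separates the two variables and exhibits a sum of
  two squares.\<close>

lemma fourier_power_nonneg:
  assumes "prob_space \<mu>" and sets [measurable_cong]: "sets \<mu> = sets borel"
  shows "0 \<le> fourier_power \<mu> u"
proof -
  interpret prob_space \<mu> by fact
  have c: "integrable \<mu> (\<lambda>x. cos (u \<bullet> x))"
    by (rule integrable_const_bound[of _ 1]) (simp, measurable)
  have s: "integrable \<mu> (\<lambda>x. sin (u \<bullet> x))"
    by (rule integrable_const_bound[of _ 1]) (simp, measurable)
  interpret pair_prob_space \<mu> \<mu> ..
  have "integrable (\<mu> \<Otimes>\<^sub>M \<mu>) (\<lambda>p. cos (u \<bullet> (fst p - snd p)))"
    by (rule P.integrable_const_bound[of _ 1]) (simp, measurable)
  then have "fourier_power \<mu> u = (\<integral>x. \<integral>y. cos (u \<bullet> (x - y)) \<partial>\<mu> \<partial>\<mu>)"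
    unfolding fourier_power_def by (subst integral_fst'[symmetric]) auto
  also have "\<dots> = (\<integral>x. \<integral>y. cos (u \<bullet> x) * cos (u \<bullet> y) + sin (u \<bullet> x) * sin (u \<bullet> y) \<partial>\<mu> \<partial>\<mu>)"
    by (simp add: inner_diff_right cos_diff)
  also have "\<dots> = (\<integral>x. cos (u \<bullet> x) \<partial>\<mu>)\<^sup>2 + (\<integral>x. sin (u \<bullet> x) \<partial>\<mu>)\<^sup>2"
    using c s by (simp add: power2_eq_square)
  finally show ?thesis by simp
qed

lemma borel_measurable_fourier_power:
  assumes "prob_space \<mu>" and sets [measurable_cong]: "sets \<mu> = sets borel"
  shows "fourier_power \<mu> \<in> borel_measurable borel"
proof -
  interpret prob_space \<mu> by fact
  interpret pair_prob_space \<mu> \<mu> ..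
  show ?thesis unfolding fourier_power_def by measurable
qed

lemma fourier_power_gaussian:
  fixes \<mu> :: "'a::euclidean_space measure" and a :: 'a
  assumes "prob_space \<mu>" and sets [measurable_cong]: "sets \<mu> = sets borel" and l: "0 < l"
  defines "I \<equiv> sqrt (pi / l) ^ DIM('a) *
    (\<integral>p. exp (- (norm (fst p - snd p))\<^sup>2 / (4 * l)) * cos (a \<bullet> (fst p - snd p)) \<partial>(\<mu> \<Otimes>\<^sub>M \<mu>))"
  shows "(\<integral>\<^sup>+u. ennreal (fourier_power \<mu> u) * ennreal (exp (- l * (norm (u - a))\<^sup>2)) \<partial>lborel) = ennreal I"
    and "0 \<le> I"
proof -
  interpret prob_space \<mu> by fact
  interpret pair_prob_space \<mu> \<mu> ..
  have b: "has_bochner_integral lborel (\<lambda>u. exp (- l * (norm (u - a))\<^sup>2) * fourier_power \<mu> u) I"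
    unfolding fourier_power_def I_def
    using gaussian_cos_integral[of "\<mu> \<Otimes>\<^sub>M \<mu>" "\<lambda>p. fst p - snd p" "\<lambda>_. 1" l a] l P.finite_measure_axioms
    by simp
  have nn: "0 \<le> exp (- l * (norm (u - a))\<^sup>2) * fourier_power \<mu> u" for u
    using fourier_power_nonneg[OF assms(1,2)] by simp
  have "(\<integral>\<^sup>+u. ennreal (exp (- l * (norm (u - a))\<^sup>2) * fourier_power \<mu> u) \<partial>lborel) = ennreal I"
    using b nn by (simp add: has_bochner_integral_iff nn_integral_eq_integral del: mult_minus_left)
  then show "(\<integral>\<^sup>+u. ennreal (fourier_power \<mu> u) * ennreal (exp (- l * (norm (u - a))\<^sup>2)) \<partial>lborel) = ennreal I"
    using fourier_power_nonneg[OF assms(1,2)] by (simp add: ennreal_mult mult.commute)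
  show "0 \<le> I" using b nn by (auto simp: has_bochner_integral_iff intro: Bochner_Integration.integral_nonneg)
qed

text \<open>A Gaussian of width \<open>R\<close> in frequency becomes one of width about
  \<open>1 / R\<close> in space, where growth applies. The bound has order
  \<open>R powr (DIM('a) - t)\<close>.\<close>

lemma nn_integral_fourier_power_gaussian_le:
  fixes \<mu> :: "'a::euclidean_space measure"
  assumes "prob_space \<mu>" and sets [measurable_cong]: "sets \<mu> = sets borel" and C: "0 \<le> C" and R: "0 < R"
    and growth: "\<And>x r. 0 < r \<Longrightarrow> emeasure \<mu> (cball x r) \<le> ennreal (C * r powr t)"
  shows "(\<integral>\<^sup>+u. ennreal (fourier_power \<mu> u) * ennreal (exp (- (1 / R\<^sup>2) * (norm u)\<^sup>2)) \<partial>lborel) \<le>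
    ennreal ((sqrt pi * R) ^ DIM('a) * (C * gaussian_shell_sum t * (R / 2) powr - t))"
proof -
  interpret prob_space \<mu> by fact
  note fst = nn_integral_fst
  interpret pair_prob_space \<mu> \<mu> ..
  let ?f = "\<lambda>p :: 'a \<times> 'a. exp (- (R / 2 * dist (snd p) (fst p))\<^sup>2)"
  have f: "?f p = exp (- (norm (fst p - snd p))\<^sup>2 / (4 * (1 / R\<^sup>2)))" for p
    by (simp add: dist_norm norm_minus_commute power_mult_distrib power_divide mult.commute)
  have i: "integrable (\<mu> \<Otimes>\<^sub>M \<mu>) ?f"
    by (rule P.integrable_const_bound[of _ 1]) auto
  have "ennreal (\<integral>p. ?f p \<partial>(\<mu> \<Otimes>\<^sub>M \<mu>)) = (\<integral>\<^sup>+p. ennreal (?f p) \<partial>(\<mu> \<Otimes>\<^sub>M \<mu>))"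
    using i by (intro nn_integral_eq_integral[symmetric]) auto
  also have "\<dots> = (\<integral>\<^sup>+x. \<integral>\<^sup>+y. ennreal (?f (x, y)) \<partial>\<mu> \<partial>\<mu>)"
    by (rule fst[symmetric]) measurable
  also have "\<dots> \<le> (\<integral>\<^sup>+x. ennreal (C * gaussian_shell_sum t * (R / 2) powr - t) \<partial>\<mu>)"
    unfolding fst_conv snd_conv using R
    by (intro nn_integral_mono nn_integral_gaussian_le growth sets C) auto
  also have "\<dots> = ennreal (C * gaussian_shell_sum t * (R / 2) powr - t)"
    by (simp add: prob_space.emeasure_space_1[OF assms(1)])
  finally have "(\<integral>p. ?f p \<partial>(\<mu> \<Otimes>\<^sub>M \<mu>)) \<le> C * gaussian_shell_sum t * (R / 2) powr - t"
    using C by (subst (asm) ennreal_le_iff) (auto simp: gaussian_shell_sum_nonneg)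
  moreover have "sqrt (pi / (1 / R\<^sup>2)) = sqrt pi * R"
    using R by (simp add: real_sqrt_mult)
  ultimately show ?thesis
    using fourier_power_gaussian(1)[OF assms(1,2), of "1 / R\<^sup>2" 0] R
    unfolding f by (auto intro!: ennreal_leI mult_left_mono)
qed

section \<open>Power near lines, and the resulting slab estimate\<close>

text \<open>For a unit vector \<open>y\<close>, integrating over \<open>r\<close> gives the
  frequency \<open>u\<close> a weight Gaussian in its distance to the line spanned by
  \<open>y\<close>.\<close>

definition directional_energy :: "'a::euclidean_space measure \<Rightarrow> 'a \<Rightarrow> ennreal" where
  "directional_energy \<mu> y = (\<integral>\<^sup>+r. \<integral>\<^sup>+u. ennreal (fourier_power \<mu> u) *
     ennreal (exp (- (norm (u - r *\<^sub>R y))\<^sup>2 / 2)) \<partial>lborel \<partial>lborel)"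

text \<open>The mean over \<open>y\<close> is finite: with the \<open>y\<close> integral innermost,
  each frequency gets its averaged weight, which is dominated by dyadic Gaussians and summed term by
  term.\<close>

lemma AE_directional_energy_finite:
  fixes \<mu> :: "'a::euclidean_space measure"
  assumes "prob_space \<mu>" and sets [measurable_cong]: "sets \<mu> = sets borel"
    and sphere: "AE y in \<mu>. norm y = 1" and C: "0 \<le> C" and t: "DIM('a) / 2 < t"
    and growth: "\<And>x r. 0 < r \<Longrightarrow> emeasure \<mu> (cball x r) \<le> ennreal (C * r powr t)"
  shows "AE y in \<mu>. directional_energy \<mu> y \<noteq> \<infinity>"
proof (rule nn_integral_PInf_AE)
  interpret prob_space \<mu> by fact
  interpret M: pair_sigma_finite "lborel :: 'a measure" \<mu> ..
  note [measurable] = borel_measurable_fourier_power[OF assms(1,2)]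
  let ?P = "\<lambda>u. ennreal (fourier_power \<mu> u)"
  let ?g = "\<lambda>u r y. ennreal (exp (- (norm (u - r *\<^sub>R y))\<^sup>2 / 2))"
  show "directional_energy \<mu> \<in> borel_measurable \<mu>"
    unfolding directional_energy_def by measurable
  have t0: "0 \<le> t" using t by (meson divide_nonneg_nonneg less_imp_le of_nat_0_le_iff order_trans zero_le_numeral)
  obtain M where M: "0 \<le> M"
    "\<And>u. (\<integral>\<^sup>+y. \<integral>\<^sup>+r. ?g u r y \<partial>lborel \<partial>\<mu>) \<le>
       ennreal M * (\<Sum>k. ennreal ((2 ^ k) powr - t) * ennreal (exp (- (1 / 4 ^ k) * (norm u)\<^sup>2)))"
    using nn_integral_gaussian_lines_le_dyadic_sum[OF assms(1,2) sphere C t0 growth] by blast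
  have "(\<integral>\<^sup>+y. directional_energy \<mu> y \<partial>\<mu>) = (\<integral>\<^sup>+y. \<integral>\<^sup>+u. \<integral>\<^sup>+r. ?P u * ?g u r y \<partial>lborel \<partial>lborel \<partial>\<mu>)"
    unfolding directional_energy_def by (intro nn_integral_cong lborel_pair.Fubini') measurable
  also have "\<dots> = (\<integral>\<^sup>+u. \<integral>\<^sup>+y. \<integral>\<^sup>+r. ?P u * ?g u r y \<partial>lborel \<partial>\<mu> \<partial>lborel)"
    by (rule M.Fubini') measurable
  also have "\<dots> = (\<integral>\<^sup>+u. ?P u * (\<integral>\<^sup>+y. \<integral>\<^sup>+r. ?g u r y \<partial>lborel \<partial>\<mu>) \<partial>lborel)"
    by (simp add: nn_integral_cmult)
  also have "\<dots> \<le> (\<integral>\<^sup>+u. ?P u * (ennreal M *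
      (\<Sum>k. ennreal ((2 ^ k) powr - t) * ennreal (exp (- (1 / 4 ^ k) * (norm u)\<^sup>2)))) \<partial>lborel)"
    by (intro nn_integral_mono mult_left_mono M) simp
  also have "\<dots> = (\<integral>\<^sup>+u. ennreal M * (\<Sum>k. ennreal ((2 ^ k) powr - t) *
      (?P u * ennreal (exp (- (1 / 4 ^ k) * (norm u)\<^sup>2)))) \<partial>lborel)"
  proof (intro nn_integral_cong)
    fix u
    show "?P u * (ennreal M * (\<Sum>k. ennreal ((2 ^ k) powr - t) * ennreal (exp (- (1 / 4 ^ k) * (norm u)\<^sup>2)))) =
      ennreal M * (\<Sum>k. ennreal ((2 ^ k) powr - t) * (?P u * ennreal (exp (- (1 / 4 ^ k) * (norm u)\<^sup>2))))"
      by (simp only: mult.left_commute[of "?P u"] ennreal_suminf_cmult[symmetric])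
  qed
  also have "\<dots> = ennreal M * (\<integral>\<^sup>+u. (\<Sum>k. ennreal ((2 ^ k) powr - t) *
      (?P u * ennreal (exp (- (1 / 4 ^ k) * (norm u)\<^sup>2)))) \<partial>lborel)"
    by (rule nn_integral_cmult) measurable
  also have "\<dots> = ennreal M * (\<Sum>k. \<integral>\<^sup>+u. ennreal ((2 ^ k) powr - t) *
      (?P u * ennreal (exp (- (1 / 4 ^ k) * (norm u)\<^sup>2))) \<partial>lborel)"
    by (subst nn_integral_suminf) auto
  also have "\<dots> = ennreal M * (\<Sum>k. ennreal ((2 ^ k) powr - t) *
      (\<integral>\<^sup>+u. ?P u * ennreal (exp (- (1 / 4 ^ k) * (norm u)\<^sup>2)) \<partial>lborel))"
    by (subst nn_integral_cmult) auto
  also have "\<dots> \<le> ennreal M * (\<Sum>k. ennreal ((2 ^ k) powr - t) *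
      ennreal ((sqrt pi * 2 ^ k) ^ DIM('a) * (C * gaussian_shell_sum t * (2 ^ k / 2) powr - t)))"
  proof (intro mult_left_mono suminf_le)
    fix k :: nat
    show "(\<integral>\<^sup>+u. ?P u * ennreal (exp (- (1 / 4 ^ k) * (norm u)\<^sup>2)) \<partial>lborel) \<le>
       ennreal ((sqrt pi * 2 ^ k) ^ DIM('a) * (C * gaussian_shell_sum t * (2 ^ k / 2) powr - t))"
      using nn_integral_fourier_power_gaussian_le[OF assms(1,2) C _ growth, of "2 ^ k"]
      by (simp add: four_power_eq)
  qed auto
  \<comment> \<open>One exponent \<open>- t\<close> comes from the averaged directions and one from
    the growth of the power spectrum; together with the volume factor they give
    \<open>DIM('a) - 2 * t\<close>.\<close>
  also have "\<dots> = ennreal M * (\<Sum>k. ennreal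
      (sqrt pi ^ DIM('a) * C * gaussian_shell_sum t * 2 powr t * (2 powr (DIM('a) - 2 * t)) ^ k))"
  proof -
    have "(2 ^ k) powr - t * ((sqrt pi * 2 ^ k) ^ DIM('a) * (C * gaussian_shell_sum t * (2 ^ k / 2) powr - t)) =
      sqrt pi ^ DIM('a) * C * gaussian_shell_sum t * 2 powr t * (2 powr (DIM('a) - 2 * t)) ^ k" for k :: nat
    proof -
      have "(2 powr (DIM('a) - 2 * t)) ^ k = (2::real) powr (real (k * DIM('a)) + - (k * t) + - (k * t))"
        by (simp add: powr_power algebra_simps)
      also have "\<dots> = (2 ^ k) ^ DIM('a) * (2 ^ k) powr - t * (2 ^ k) powr - t"
      proof -
        have "(2::real) powr real (k * DIM('a)) = (2 ^ k) ^ DIM('a)"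
          by (subst powr_realpow) (simp_all add: power_mult)
        moreover have "(2::real) powr - (k * t) = (2 ^ k) powr - t"
          by (simp add: powr_powr flip: powr_realpow)
        ultimately show ?thesis by (simp only: powr_add)
      qed
      finally have "(2 powr (DIM('a) - 2 * t)) ^ k = (2 ^ k) ^ DIM('a) * (2 ^ k) powr - t * (2 ^ k) powr - t" .
      moreover have "(2 ^ k / 2) powr - t = (2 ^ k) powr - t * 2 powr t"
        by (simp add: powr_divide powr_minus_divide)
      ultimately show ?thesis by (simp add: power_mult_distrib mult_ac)
    qed
    then show ?thesis by (simp only: ennreal_mult'[OF powr_ge_zero, symmetric])
  qed
  also have "\<dots> = ennreal M * ennreal (\<Sum>k.
      sqrt pi ^ DIM('a) * C * gaussian_shell_sum t * 2 powr t * (2 powr (DIM('a) - 2 * t)) ^ k)"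
  proof -
    \<comment> \<open>The ratio of the geometric series is below 1 because \<open>t\<close> exceeds
      half the dimension.\<close>
    have "(2::real) powr (DIM('a) - 2 * t) < 2 powr 0"
      using t by (subst powr_less_cancel_iff) auto
    then show ?thesis using C
      by (subst suminf_ennreal2) (auto simp: gaussian_shell_sum_nonneg intro!: summable_mult summable_geometric mult_nonneg_nonneg)
  qed
  also have "\<dots> < \<infinity>" by (simp add: ennreal_mult_less_top)
  finally show "(\<integral>\<^sup>+y. directional_energy \<mu> y \<partial>\<mu>) \<noteq> \<infinity>" by simp
qed

text \<open>The energy bounds the integral in \<open>r\<close> of the Fourier transform of the law
  of \<open>y \<bullet> (x - x')\<close>, weighted by a Gaussian in \<open>x - x'\<close>. An
  integrable transform forces a bounded density, hence mass of order \<delta> near 0. The weight is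
  harmless since differences on the sphere have norm at most 2.\<close>

lemma slab_correlation_bound:
  fixes \<mu> :: "'a::euclidean_space measure"
  assumes "prob_space \<mu>" and sets [measurable_cong]: "sets \<mu> = sets borel"
    and sphere: "AE x in \<mu>. norm x = 1" and fin: "directional_energy \<mu> y \<noteq> \<infinity>"
  obtains C where "0 \<le> C" "\<And>\<delta>. 0 < \<delta> \<Longrightarrow>
    (\<integral>\<^sup>+x. \<integral>\<^sup>+x'. indicator {..\<delta>} \<bar>y \<bullet> (x - x')\<bar> \<partial>\<mu> \<partial>\<mu>) \<le> ennreal (C * \<delta>)"
proof -
  interpret prob_space \<mu> by fact
  note fst = nn_integral_fst
  interpret pair_prob_space \<mu> \<mu> ..
  obtain F where F: "directional_energy \<mu> y = ennreal F" "0 \<le> F"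
    using fin by (cases "directional_energy \<mu> y") auto
  let ?Q = "\<mu> \<Otimes>\<^sub>M \<mu>"
  let ?z = "\<lambda>p :: 'a \<times> 'a. fst p - snd p"
  let ?w = "\<lambda>p. exp (- (norm (?z p))\<^sup>2 / 2)"
  \<comment> \<open>Up to a constant factor, \<open>A r\<close> is the inner integral of
    \<open>directional_energy\<close> at \<open>r\<close>; in particular it is nonnegative.\<close>
  define A where "A r = (\<integral>p. ?w p * cos (r * (y \<bullet> ?z p)) \<partial>?Q)" for r
  have A: "(\<integral>\<^sup>+u. ennreal (fourier_power \<mu> u) * ennreal (exp (- (norm (u - r *\<^sub>R y))\<^sup>2 / 2)) \<partial>lborel) =
      ennreal (sqrt (2 * pi) ^ DIM('a) * A r)"
    and A0: "0 \<le> sqrt (2 * pi) ^ DIM('a) * A r" for r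
    using fourier_power_gaussian[OF assms(1,2), of "1 / 2" "r *\<^sub>R y"] by (simp_all add: A_def mult.commute)
  have A_nonneg: "0 \<le> A r" for r
  proof -
    have "0 < sqrt (2 * pi) ^ DIM('a)" by simp
    then show ?thesis using A0[of r] unfolding zero_le_mult_iff by linarith
  qed
  have "(1::real) \<le> sqrt (2 * pi)" using pi_gt3 by simp
  then have "1 * A r \<le> sqrt (2 * pi) ^ DIM('a) * A r" for r
    by (intro mult_right_mono A_nonneg one_le_power)
  then have "(\<integral>\<^sup>+r. ennreal (A r) \<partial>lborel) \<le> (\<integral>\<^sup>+r. ennreal (sqrt (2 * pi) ^ DIM('a) * A r) \<partial>lborel)"
    by (intro nn_integral_mono ennreal_leI) simp
  also have "\<dots> = ennreal F"
    unfolding A[symmetric] F(1)[symmetric] directional_energy_def ..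
  finally have AF: "(\<integral>\<^sup>+r. ennreal (A r) \<partial>lborel) \<le> ennreal F" .
  show thesis
  \<comment> \<open>In the exponent, 2 pays for \<open>(norm (x - x'))\<^sup>2 / 2\<close> on the
    unit sphere and 1/2 for the slab Gaussian where
    \<open>\<bar>y \<bullet> (x - x')\<bar> \<le> \<delta>\<close>.\<close>
  proof (rule that[of "exp (5 / 2) * F"])
    show "0 \<le> exp (5 / 2) * F" using F by simp
    fix \<delta> :: real assume \<delta>: "0 < \<delta>"
    \<comment> \<open>Damping the line integral by a Gaussian in \<open>r\<close> of width \<open>1/\<delta>\<close> turns it into a smoothed slab indicator of width \<open>\<delta>\<close>.\<close>
    let ?v = "\<lambda>p. ?w p * exp (- (norm (y \<bullet> ?z p))\<^sup>2 / (4 * (\<delta>\<^sup>2 / 2)))"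
    define B where "B = (\<integral>p. ?v p \<partial>?Q)"
    have "has_bochner_integral lborel (\<lambda>r. exp (- (\<delta>\<^sup>2 / 2) * (norm (r - 0))\<^sup>2) * A r)
        (sqrt (pi / (\<delta>\<^sup>2 / 2)) ^ DIM(real) * (\<integral>p. ?v p * cos (0 \<bullet> (y \<bullet> ?z p)) \<partial>?Q))"
      using gaussian_cos_integral[of ?Q "\<lambda>p. y \<bullet> ?z p" ?w "\<delta>\<^sup>2 / 2" 0] \<delta> P.finite_measure_axioms
      unfolding A_def by simp
    also have "sqrt (pi / (\<delta>\<^sup>2 / 2)) ^ DIM(real) * (\<integral>p. ?v p * cos (0 \<bullet> (y \<bullet> ?z p)) \<partial>?Q) = sqrt (2 * pi) / \<delta> * B"
      using \<delta> by (simp add: B_def real_sqrt_divide mult.commute)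
    finally have "ennreal (sqrt (2 * pi) / \<delta> * B) = (\<integral>\<^sup>+r. ennreal (exp (- (\<delta>\<^sup>2 / 2) * (norm (r - 0))\<^sup>2) * A r) \<partial>lborel)"
      using A_nonneg by (simp add: has_bochner_integral_iff nn_integral_eq_integral)
    also have "\<dots> \<le> (\<integral>\<^sup>+r. ennreal (A r) \<partial>lborel)"
      using A_nonneg by (intro nn_integral_mono ennreal_leI mult_left_le_one_le) auto
    also note AF
    finally have "sqrt (2 * pi) / \<delta> * B \<le> F" using F(2) by (simp add: ennreal_le_iff)
    moreover have "0 \<le> B" unfolding B_def by (intro Bochner_Integration.integral_nonneg) auto
    then have "1 * B \<le> sqrt (2 * pi) * B"
      using \<open>1 \<le> sqrt (2 * pi)\<close> by (intro mult_right_mono)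
    ultimately have B: "B \<le> F * \<delta>" using \<delta> by (simp add: field_simps)
    have iv: "integrable ?Q ?v"
      by (rule P.integrable_const_bound[of _ 1]) (auto intro!: mult_le_one)
    have pt: "indicator {..\<delta>} \<bar>y \<bullet> (x - x')\<bar> \<le> ennreal (exp (5 / 2)) * ennreal (?v (x, x'))"
      if "norm x = 1" "norm x' = 1" for x x'
    proof (cases "\<bar>y \<bullet> (x - x')\<bar> \<le> \<delta>")
      case True
      then have 1: "(y \<bullet> (x - x'))\<^sup>2 \<le> \<delta>\<^sup>2" by (simp add: abs_le_square_iff[symmetric])
      have "norm (x - x') \<le> 2" using norm_triangle_ineq4[of x x'] that by simp
      then have "(norm (x - x'))\<^sup>2 \<le> 2\<^sup>2" by (intro power_mono) auto
      moreover have "(y \<bullet> (x - x'))\<^sup>2 / (2 * \<delta>\<^sup>2) \<le> 1 / 2" using 1 \<delta> by (simp add: field_simps)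
      ultimately have "1 \<le> exp (5 / 2 + (- (norm (x - x'))\<^sup>2 / 2) + (- (y \<bullet> (x - x'))\<^sup>2 / (2 * \<delta>\<^sup>2)))"
        by simp
      then have "ennreal 1 \<le> ennreal (exp (5 / 2) * ?v (x, x'))"
        unfolding exp_add by (intro ennreal_leI) (simp add: mult.assoc)
      then show ?thesis using True by (simp add: ennreal_mult)
    qed simp
    have "(\<integral>\<^sup>+x. \<integral>\<^sup>+x'. indicator {..\<delta>} \<bar>y \<bullet> (x - x')\<bar> \<partial>\<mu> \<partial>\<mu>) \<le>
        (\<integral>\<^sup>+x. \<integral>\<^sup>+x'. ennreal (exp (5 / 2)) * ennreal (?v (x, x')) \<partial>\<mu> \<partial>\<mu>)"
      by ((rule nn_integral_mono_AE, rule AE_mp[OF sphere], rule AE_I2, rule impI)+, rule pt)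
    also have "\<dots> = ennreal (exp (5 / 2)) * (\<integral>\<^sup>+x. \<integral>\<^sup>+x'. ennreal (?v (x, x')) \<partial>\<mu> \<partial>\<mu>)"
      by (simp add: nn_integral_cmult)
    also have "(\<integral>\<^sup>+x. \<integral>\<^sup>+x'. ennreal (?v (x, x')) \<partial>\<mu> \<partial>\<mu>) = (\<integral>\<^sup>+p. ennreal (?v p) \<partial>?Q)"
      by (rule fst) measurable
    also have "\<dots> = ennreal B"
      unfolding B_def using iv by (intro nn_integral_eq_integral) auto
    also have "ennreal (exp (5 / 2)) * ennreal B \<le> ennreal (exp (5 / 2) * F * \<delta>)"
      using B \<open>0 \<le> B\<close> by (auto simp flip: ennreal_mult intro!: ennreal_leI simp: mult.assoc)
    finally show "(\<integral>\<^sup>+x. \<integral>\<^sup>+x'. indicator {..\<delta>} \<bar>y \<bullet> (x - x')\<bar> \<partial>\<mu> \<partial>\<mu>) \<le> ennreal (exp (5 / 2) * F * \<delta>)" .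
  qed
qed

section \<open>From the Frostman condition to the distance set\<close>

text \<open>Taking \<epsilon> to be \<open>hausdorff_dim E - t\<close> gives the exponent
  \<open>t\<close> for small radii. Radii from some \<open>b\<close> on are covered by the total
  mass 1, at the cost of \<open>b powr - t\<close> in the constant.\<close>

lemma frostman_measure_growth:
  fixes \<mu> :: "'a::euclidean_space measure"
  assumes \<mu>: "frostman_measure_on E \<mu>" and t: "0 \<le> t" "t < hausdorff_dim E"
  obtains C where "0 \<le> C" "\<And>x r. 0 < r \<Longrightarrow> emeasure \<mu> (cball x r) \<le> ennreal (C * r powr t)"
proof -
  interpret prob_space \<mu> using \<mu> by (simp add: frostman_measure_on_def)
  have "0 < hausdorff_dim E - t" using t by simp
  then have "\<exists>C. \<forall>\<^sub>F r in at_right 0. \<forall>x. measure \<mu> (cball x r) \<le>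
      C * r powr (hausdorff_dim E - (hausdorff_dim E - t))"
    using \<mu> unfolding frostman_measure_on_def by blast
  then obtain C where "\<forall>\<^sub>F r in at_right 0. \<forall>x. measure \<mu> (cball x r) \<le> C * r powr t"
    by auto
  then obtain b where b: "0 < b" "\<And>r x. 0 < r \<Longrightarrow> r < b \<Longrightarrow> measure \<mu> (cball x r) \<le> C * r powr t"
    by (auto simp: eventually_at_right_field)
  show thesis
  proof (rule that[of "\<bar>C\<bar> + b powr - t"])
    fix x :: 'a and r :: real assume r: "0 < r"
    have "measure \<mu> (cball x r) \<le> (\<bar>C\<bar> + b powr - t) * r powr t"
    proof (cases "r < b")
      case True
      have "measure \<mu> (cball x r) \<le> C * r powr t" using b(2) r True .
      also have "\<dots> \<le> (\<bar>C\<bar> + b powr - t) * r powr t"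
        using abs_ge_self[of C] powr_ge_zero[of b "- t"] by (intro mult_right_mono) (linarith, simp)
      finally show ?thesis .
    next
      case False
      have "measure \<mu> (cball x r) \<le> b powr - t * b powr t"
        using b(1) by (simp flip: powr_add)
      also have "\<dots> \<le> (\<bar>C\<bar> + b powr - t) * r powr t"
        using b(1) False t by (intro mult_mono powr_mono2) auto
      finally show ?thesis .
    qed
    then show "emeasure \<mu> (cball x r) \<le> ennreal ((\<bar>C\<bar> + b powr - t) * r powr t)"
      unfolding emeasure_eq_measure by (rule ennreal_leI)
  qed simp
qed

theorem corollary1p1p1:
  fixes E :: "(real ^ 'n) set" and \<mu> :: "(real ^ 'n) measure"
  assumes "CARD('n) \<ge> 2"
    and "E \<subseteq> sphere 0 1"
    and "hausdorff_dim E > real CARD('n) / 2"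
    and "frostman_measure_on E \<mu>"
  shows "AE y in \<mu>. y \<in> E \<longrightarrow> outer_measure_of lborel {norm (x - y) | x. x \<in> E} > 0"
proof -
  have sets [measurable_cong]: "sets \<mu> = sets borel" and prob: "prob_space \<mu>" and E: "AE x in \<mu>. x \<in> E"
    using assms(4) by (auto simp: frostman_measure_on_def)
  interpret prob_space \<mu> by fact
  have sphere: "AE x in \<mu>. norm x = 1"
    using E by eventually_elim (use assms(2) in auto)
  obtain t where t: "real CARD('n) / 2 < t" "t < hausdorff_dim E"
    using dense[OF assms(3)] by blast
  have t0: "0 \<le> t" using t(1) by (rule less_imp_le[OF le_less_trans[rotated]]) simp
  obtain C where "0 \<le> C" "\<And>x r. 0 < r \<Longrightarrow> emeasure \<mu> (cball x r) \<le> ennreal (C * r powr t)"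
    using frostman_measure_growth[OF assms(4) t0 t(2)] by blast
  then have "AE y in \<mu>. directional_energy \<mu> y \<noteq> \<infinity>"
    using t by (intro AE_directional_energy_finite[OF prob sets sphere]) auto
  with sphere show ?thesis
  proof eventually_elim
    case (elim y)
    obtain C where C: "0 \<le> C" "\<And>\<delta>. 0 < \<delta> \<Longrightarrow>
        (\<integral>\<^sup>+x. \<integral>\<^sup>+x'. indicator {..\<delta>} \<bar>y \<bullet> (x - x')\<bar> \<partial>\<mu> \<partial>\<mu>) \<le> ennreal (C * \<delta>)"
      using slab_correlation_bound[OF prob sets sphere elim(2)] by blast
    \<comment> \<open>The law of the distance to \<open>y\<close>. If it vanishes on Lebesgue null
      sets, the distances from \<open>y\<close> to almost all points cannot lie in a null
      set.\<close>
    define \<rho> where "\<rho> = distr \<mu> borel (\<lambda>x. norm (x - y))"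
    have \<rho>: "prob_space \<rho>" "sets \<rho> = sets borel"
      unfolding \<rho>_def by (auto intro!: prob_space_distr)
    have corr: "(\<integral>\<^sup>+u. \<integral>\<^sup>+v. indicator {..\<delta>} \<bar>u - v\<bar> \<partial>\<rho> \<partial>\<rho>) \<le> ennreal (2 * C * \<delta>)" if \<delta>: "0 < \<delta>" for \<delta>
    proof -
      have pt: "\<bar>y \<bullet> (x - x')\<bar> \<le> 2 * \<delta>"
        if n: "norm x = 1" "norm x' = 1" and le: "\<bar>norm (x - y) - norm (x' - y)\<bar> \<le> \<delta>" for x x'
      proof -
        \<comment> \<open>On the sphere the projection is an affine function of the squared
          distance. Factoring the difference of squares, with each distance at most 2, turns
          closeness \<delta> of distances into closeness \<open>2 * \<delta>\<close> of
          projections.\<close>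
        have "2 * (y \<bullet> (x - x')) = (norm (x' - y))\<^sup>2 - (norm (x - y))\<^sup>2"
          using n unfolding power2_norm_eq_inner norm_eq_1
          by (simp add: inner_diff inner_commute)
        also have "\<dots> = (norm (x' - y) - norm (x - y)) * (norm (x' - y) + norm (x - y))"
          by (simp add: power2_eq_square algebra_simps)
        finally have "2 * \<bar>y \<bullet> (x - x')\<bar> = \<bar>norm (x' - y) - norm (x - y)\<bar> * (norm (x' - y) + norm (x - y))"
          by (metis abs_mult abs_numeral abs_of_nonneg add_nonneg_nonneg norm_ge_zero)
        also have "\<dots> \<le> \<delta> * (2 + 2)"
          using le n elim(1) \<delta> norm_triangle_ineq4[of x y] norm_triangle_ineq4[of x' y]
          by (intro mult_mono add_mono) auto
        finally show ?thesis by simp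
      qed
      have "(\<integral>\<^sup>+u. \<integral>\<^sup>+v. indicator {..\<delta>} \<bar>u - v\<bar> \<partial>\<rho> \<partial>\<rho>) =
          (\<integral>\<^sup>+x. \<integral>\<^sup>+x'. indicator {..\<delta>} \<bar>norm (x - y) - norm (x' - y)\<bar> \<partial>\<mu> \<partial>\<mu>)"
        unfolding \<rho>_def
        by (subst nn_integral_distr, measurable) (auto intro!: nn_integral_cong nn_integral_distr)
      also have "\<dots> \<le> (\<integral>\<^sup>+x. \<integral>\<^sup>+x'. indicator {..2 * \<delta>} \<bar>y \<bullet> (x - x')\<bar> \<partial>\<mu> \<partial>\<mu>)"
        by ((rule nn_integral_mono_AE, rule AE_mp[OF sphere], rule AE_I2, rule impI)+, auto simp: indicator_def pt)
      also have "\<dots> \<le> ennreal (C * (2 * \<delta>))" using \<delta> by (intro C) simp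
      finally show ?thesis by (simp add: mult_ac)
    qed
    show ?case
    proof (rule ccontr)
      assume "\<not> (y \<in> E \<longrightarrow> 0 < outer_measure_of lborel {norm (x - y) | x. x \<in> E})"
      then have "outer_measure_of lborel {norm (x - y) | x. x \<in> E} = 0"
        by (simp add: not_less)
      \<comment> \<open>A measurable null hull replaces the distance set, whose measurability is not
        known. Almost every \<open>x\<close> lies in \<open>E\<close>, so \<open>N\<close> has full
        \<rho>-measure, contradicting that it must have measure 0.\<close>
      then obtain N where N: "N \<in> sets lborel" "{norm (x - y) | x. x \<in> E} \<subseteq> N" "emeasure lborel N = 0"
        using outer_measure_of_attain[of "{norm (x - y) | x. x \<in> E}" lborel] by auto
      have [measurable]: "N \<in> sets borel" using N by simp
      have "emeasure \<rho> N = 0"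
        using N C(1) corr \<rho> by (intro emeasure_null_set_eq_0_if_correlation_bound[of \<rho> N "2 * C"]) auto
      then have "emeasure \<mu> {x \<in> space \<mu>. norm (x - y) \<in> N} = 0"
        unfolding \<rho>_def by (subst (asm) emeasure_distr) (auto simp: vimage_def Int_def conj_commute)
      moreover have "AE x in \<mu>. norm (x - y) \<in> N"
        using E by eventually_elim (use N(2) in blast)
      then have "emeasure \<mu> {x \<in> space \<mu>. norm (x - y) \<in> N} = 1"
        by (intro emeasure_eq_1_AE) auto
      ultimately show False by simp
    qed
  qed
qed

end
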